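(* For $a,b>0$ define $\phi_{a,b}:(0,\infty)\to\mathbb R$ by $$\phi_{a,b}(x)=\log \frac{\Gamma(x+a+b)\Gamma(x)}{\Gamma(x+a)\Gamma(x+b)}- b\log \left(1+\frac{a}{x}\right).$$ Then the following assertions hold. (a) The function $\phi_{a,b}$ is a generalized Stieltjes function of order $3$ for all $a>0$ and $0<b<1$. (b) The function $-\phi_{a,b}$ is a generalized Stieltjes function of order $3$ for all $a>0$ and $b>1$.
   Context: $\Gamma$ denotes Euler's Gamma function. For $\lambda>0$, a function $f:(0,\infty)\to\mathbb R$ is called a generalized Stieltjes function of order $\lambda$ if there exist a real constant $c\ge 0$ and a positive measure $\nu$ on $[0,\infty)$ such that $$f(x)=c+\int_0^\infty \frac{d\nu(t)}{(t+x)^\lambda},\quad x>0,$$ where the integral converges for all $x>0$. *)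

theory Defs
  imports "HOL-Analysis.Analysis"
begin

text \<open>
  Functions on the open half-line are represented by total functions on the reals of which only
  the values at positive arguments matter. The measure lives on the Borel subsets of
  \<open>[0, \<infinity>)\<close>; it may be infinite, and integrability for all \<open>x > 0\<close> is the convergence
  requirement (the integrand is nonnegative), which forces it to be finite on bounded sets.
\<close>

definition generalized_stieltjes :: "real \<Rightarrow> (real \<Rightarrow> real) \<Rightarrow> bool" where
  "generalized_stieltjes p f \<longleftrightarrow>
     p > 0 \<and>
     (\<exists>c \<nu>. c \<ge> 0 \<and>
        sets \<nu> = sets (restrict_space borel {0..}) \<and>
        (\<forall>x>0. integrable \<nu> (\<lambda>t. 1 / (t + x) powr p) \<and>
               f x = c + (\<integral>t. 1 / (t + x) powr p \<partial>\<nu>)))"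

definition stieltjes_phi :: "real \<Rightarrow> real \<Rightarrow> real \<Rightarrow> real" where
  "stieltjes_phi a b x =
     ln (Gamma (x + a + b) * Gamma x / (Gamma (x + a) * Gamma (x + b))) - b * ln (1 + a / x)"

end

theory Submission
  imports Defs
begin

text \<open>
  By the Gauss product for \<open>\<Gamma>\<close>, \<open>ln \<Gamma>(x) - ln \<Gamma>(x + b) + b ln x\<close> is the sum over \<open>n\<close> of
  \<open>q(x + n)\<close> with \<open>q(y) = ln (1 + b/y) - b ln (1 + 1/y)\<close>, and \<open>stieltjes_phi a b x\<close> is the
  difference of this function at \<open>x\<close> and \<open>x + a\<close>. Up to sign, \<open>q\<close> is
  \<open>M ln (1 + m/y) - m ln (1 + M/y)\<close> with \<open>{m, M} = {b, 1}\<close>, \<open>m < M\<close>, whose negated derivative is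
  \<open>\<integral> 2 T(s) / (s + y)\<^sup>3 ds\<close> for a nonnegative tent function \<open>T\<close> supported on \<open>[0, M]\<close>. Hence
  \<open>q(y) - q(y + a)\<close> integrates \<open>2 T(s) / (s + u + y)\<^sup>3\<close> over \<open>s\<close> and \<open>u \<in> [0, a]\<close>; the
  representing measure is the image of \<open>2 T(s) ds du\<close>, summed over \<open>n\<close>, under
  \<open>(n, u, s) \<mapsto> n + u + s\<close>.
\<close>

text \<open>A finite value of the nonnegative integral yields integrability and the Bochner integral
  at once, so the measure can be handled entirely in \<open>ennreal\<close>. The constant is
  \<open>c = 0\<close>.\<close>

lemma generalized_stieltjesI_nn_integral:
  assumes "p > 0" and sets: "sets \<nu> = sets (restrict_space borel {0..})"
    and nonneg: "\<And>x. x > 0 \<Longrightarrow> f x \<ge> 0"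
    and eq: "\<And>x. x > 0 \<Longrightarrow> (\<integral>\<^sup>+t. ennreal (1 / (t + x) powr p) \<partial>\<nu>) = ennreal (f x)"
  shows "generalized_stieltjes p f"
proof -
  have "has_bochner_integral \<nu> (\<lambda>t. 1 / (t + x) powr p) (f x)" if "x > 0" for x
  proof (rule has_bochner_integral_nn_integral)
    have "(\<lambda>t. 1 / (t + x) powr p) \<in> borel_measurable (restrict_space borel {0..})"
      by (intro measurable_restrict_space1) measurable
    then show "(\<lambda>t. 1 / (t + x) powr p) \<in> borel_measurable \<nu>"
      by (simp add: measurable_cong_sets[OF sets refl])
  qed (use nonneg eq that in auto)
  then have "\<forall>x>0. integrable \<nu> (\<lambda>t. 1 / (t + x) powr p) \<and>
               f x = 0 + (\<integral>t. 1 / (t + x) powr p \<partial>\<nu>)"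
    by (auto simp: has_bochner_integral_iff)
  with assms(1) sets show ?thesis
    unfolding generalized_stieltjes_def by blast
qed

text \<open>On s >= 0 this is \<open>M * min s m - m * min s M\<close>. It arises because 1/y - 1/(y
  + m), the negated derivative of ln (1 + m/y), is the integral of 2 min(s, m) / (s + y)^3 over s >=
  0.\<close>

definition tent :: "real \<Rightarrow> real \<Rightarrow> real \<Rightarrow> real" where
  "tent m M s = (if s < 0 \<or> M < s then 0 else if s \<le> m then (M - m) * s else m * (M - s))"

lemma tent_nonneg: "0 < m \<Longrightarrow> m < M \<Longrightarrow> tent m M s \<ge> 0"
  by (auto simp: tent_def)

lemma borel_measurable_tent [measurable]: "tent m M \<in> borel_measurable borel"
  unfolding tent_def by measurable

lemma nn_integral_tent:
  fixes m M z :: real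
  assumes "0 < m" "m < M" "0 < z"
  shows "(\<integral>\<^sup>+s. ennreal (2 * tent m M s / (s + z) ^ 3) \<partial>lborel) =
         ennreal (m * M * (M - m) / (z * (z + m) * (z + M)))"
proof -
  let ?f1 = "\<lambda>s. (M - m) * s * 2 / (s + z) ^ 3"
  let ?f2 = "\<lambda>s. m * (M - s) * 2 / (s + z) ^ 3"
  \<comment> \<open>The derivatives of s/(s + z) and (M - s)/(s + z) are z/(s + z)^2 and -(M + z)/(s
    + z)^2, so multiples of their squares are primitives. They vanish at 0 and \<open>M\<close>
    respectively; only the values at \<open>m\<close> survive.\<close>
  let ?F1 = "\<lambda>s. (M - m) / z * (s / (s + z)) ^ 2"
  let ?F2 = "\<lambda>s. - m / (M + z) * ((M - s) / (s + z)) ^ 2"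
  have I1: "(\<integral>\<^sup>+s. ennreal (?f1 s) * indicator {0..m} s \<partial>lborel) = ennreal (?F1 m - ?F1 0)"
  proof (rule nn_integral_FTC_Icc[where F = ?F1 and f = ?f1])
    fix s assume s: "s \<in> {0..m}"
    have "s + z \<noteq> 0" using s assms by auto
    then show "(?F1 has_real_derivative ?f1 s) (at s)"
      using assms
      by (auto intro!: derivative_eq_intros simp: divide_simps power2_eq_square power3_eq_cube)
         (auto simp: algebra_simps)
  qed (use assms in auto)
  have I2: "(\<integral>\<^sup>+s. ennreal (?f2 s) * indicator {m..M} s \<partial>lborel) = ennreal (?F2 M - ?F2 m)"
  proof (rule nn_integral_FTC_Icc[where F = ?F2 and f = ?f2])
    fix s assume s: "s \<in> {m..M}"
    have "s + z \<noteq> 0" "M + z \<noteq> 0" using s assms by auto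
    then show "(?F2 has_real_derivative ?f2 s) (at s)"
      by (auto intro!: derivative_eq_intros simp: divide_simps power2_eq_square power3_eq_cube)
         (auto simp: algebra_simps)
  qed (use assms in auto)
  have "(\<integral>\<^sup>+s. ennreal (2 * tent m M s / (s + z) ^ 3) \<partial>lborel) =
        (\<integral>\<^sup>+s. ennreal (?f1 s) * indicator {0..m} s + ennreal (?f2 s) * indicator {m..M} s \<partial>lborel)"
  proof (intro nn_integral_cong_AE)
    show "AE s in lborel. ennreal (2 * tent m M s / (s + z) ^ 3) =
        ennreal (?f1 s) * indicator {0..m} s + ennreal (?f2 s) * indicator {m..M} s"
      \<comment> \<open>The two intervals share the point \<open>m\<close>, where the sum counts the
        integrand twice.\<close>
      using AE_lborel_singleton[of m]
      by eventually_elim (use assms in \<open>auto simp: tent_def indicator_def algebra_simps\<close>)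
  qed
  also have "\<dots> = ennreal (?F1 m - ?F1 0) + ennreal (?F2 M - ?F2 m)"
    by (subst nn_integral_add) (simp_all add: I1 I2 del: ennreal_plus)
  also have "\<dots> = ennreal ((?F1 m - ?F1 0) + (?F2 M - ?F2 m))"
    using assms by (intro ennreal_plus[symmetric]) auto
  also have "(?F1 m - ?F1 0) + (?F2 M - ?F2 m) = m * M * (M - m) / (z * (z + m) * (z + M))"
  proof -
    \<comment> \<open>With the denominators as variables and \<open>m\<close>, \<open>M\<close>
      eliminated, clearing fractions leaves a polynomial identity.\<close>
    define p q where "p = z + m" and "q = z + M"
    have "z \<noteq> 0" "p \<noteq> 0" "q \<noteq> 0" "m = p - z" "M = q - z"
      using assms by (auto simp: p_def q_def)
    then show ?thesis
      by (simp add: divide_simps power2_eq_square) (simp add: algebra_simps)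
  qed
  finally show ?thesis .
qed

text \<open>The weights cancel the leading terms m M / y at infinity. \<open>log_gap b 1\<close> is
  the summand q of the overview and \<open>log_gap 1 b\<close> is -q.\<close>

definition log_gap :: "real \<Rightarrow> real \<Rightarrow> real \<Rightarrow> real" where
  "log_gap m M y = M * ln (1 + m / y) - m * ln (1 + M / y)"

lemma has_real_derivative_log_gap:
  assumes "0 < m" "0 < M" "0 < y"
  shows "(log_gap m M has_real_derivative - (m * M * (M - m) / (y * (y + m) * (y + M)))) (at y)"
proof -
  have nz: "y \<noteq> 0" "y + m \<noteq> 0" "y + M \<noteq> 0" and pos: "1 + m / y > 0" "1 + M / y > 0"
    using assms by (auto intro: add_pos_pos)
  have "(log_gap m M has_real_derivative
           M * ((- m / y\<^sup>2) / (1 + m / y)) - m * ((- M / y\<^sup>2) / (1 + M / y))) (at y)"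
    unfolding log_gap_def using nz pos
    by (auto intro!: derivative_eq_intros simp: power2_eq_square mult_ac)
  also have "M * ((- m / y\<^sup>2) / (1 + m / y)) - m * ((- M / y\<^sup>2) / (1 + M / y)) =
        - (m * M * (M - m) / (y * (y + m) * (y + M)))"
  proof -
    have "1 + m / y = (y + m) / y" "1 + M / y = (y + M) / y" using nz by (auto simp: field_simps)
    then show ?thesis
      using nz by (simp add: divide_simps power2_eq_square) (simp add: algebra_simps)
  qed
  finally show ?thesis .
qed

lemma log_gap_antimono:
  assumes "0 < m" "m < M" "0 < y" "0 \<le> a"
  shows "log_gap m M (y + a) \<le> log_gap m M y"
proof (rule DERIV_nonpos_imp_nonincreasing[where f = "log_gap m M"])
  fix z assume "y \<le> z" "z \<le> y + a"
  then show "\<exists>d. (log_gap m M has_real_derivative d) (at z) \<and> d \<le> 0"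
    using assms
    by (intro exI[of _ "- (m * M * (M - m) / (z * (z + m) * (z + M)))"] conjI
          has_real_derivative_log_gap) auto
qed (use assms in auto)

text \<open>By \<open>nn_integral_tent\<close> the inner integral is minus the derivative of
  \<open>log_gap m M\<close> at \<open>y + u\<close>, so integrating over \<open>u\<close> gives the
  decrease from \<open>y\<close> to \<open>y + a\<close>. The kernel depends only on
  \<open>s + u + y\<close>, which is what permits a pushforward under addition.\<close>

lemma nn_integral_tent_shift:
  assumes "0 < m" "m < M" "0 < y" "0 \<le> a"
  shows "(\<integral>\<^sup>+u. (\<integral>\<^sup>+s. ennreal (2 * tent m M s / (s + (y + u)) ^ 3) \<partial>lborel) * indicator {0..a} u \<partial>lborel)
         = ennreal (log_gap m M y - log_gap m M (y + a))"
proof -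
  let ?r = "\<lambda>u. m * M * (M - m) / ((y + u) * (y + u + m) * (y + u + M))"
  have "(\<integral>\<^sup>+u. (\<integral>\<^sup>+s. ennreal (2 * tent m M s / (s + (y + u)) ^ 3) \<partial>lborel) * indicator {0..a} u \<partial>lborel)
        = (\<integral>\<^sup>+u. ennreal (?r u) * indicator {0..a} u \<partial>lborel)"
    using assms by (intro nn_integral_cong) (auto simp: nn_integral_tent split: split_indicator)
  also have "\<dots> = ennreal (- log_gap m M (y + a) - - log_gap m M (y + 0))"
  proof (rule nn_integral_FTC_Icc[where F = "\<lambda>u. - log_gap m M (y + u)" and f = ?r])
    fix u assume u: "u \<in> {0..a}"
    have "((\<lambda>u. log_gap m M (y + u)) has_real_derivative - ?r u) (at u)"
      using has_real_derivative_log_gap[of m M "u + y"] assms u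
      by (simp add: DERIV_shift add.commute[of y])
    from DERIV_minus[OF this]
    show "((\<lambda>u. - log_gap m M (y + u)) has_real_derivative ?r u) (at u)" by simp
  qed (use assms in auto)
  finally show ?thesis by simp
qed

text \<open>Tonelli turns the integral against the pushforward measure into a series of the
  integrals in \<open>nn_integral_tent_shift\<close>. Leaving \<open>f\<close> arbitrary lets one
  construction serve both signs of \<open>stieltjes_phi\<close>.\<close>

lemma generalized_stieltjes_sums_log_gap:
  assumes m: "0 < m" "m < M" and a: "0 \<le> a"
    and sums: "\<And>x. x > 0 \<Longrightarrow>
      (\<lambda>n. log_gap m M (x + real n) - log_gap m M (x + real n + a)) sums f x"
  shows "generalized_stieltjes 3 f"
proof -
  define P where "P = (count_space (UNIV :: nat set) \<Otimes>\<^sub>M (lborel :: real measure)) \<Otimes>\<^sub>M (lborel :: real measure)"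
  define w :: "(nat \<times> real) \<times> real \<Rightarrow> ennreal"
    where "w = (\<lambda>v. ennreal (2 * tent m M (snd v)) * indicator {0..a} (snd (fst v)))"
  \<comment> \<open>The density \<open>w\<close> vanishes where the maximum is not \<open>n + u + s\<close>;
    the maximum only forces values in \<open>[0, \<infinity>)\<close>.\<close>
  define h :: "(nat \<times> real) \<times> real \<Rightarrow> real"
    where "h = (\<lambda>v. max 0 (real (fst (fst v)) + snd (fst v) + snd v))"
  define \<nu> where "\<nu> = distr (density P w) (restrict_space borel {0..}) h"
  have w [measurable]: "w \<in> borel_measurable P"
    unfolding w_def P_def by measurable
  have "h \<in> borel_measurable P"
    unfolding h_def P_def by measurable
  then have h [measurable]: "h \<in> measurable P (restrict_space borel {0..})"
    by (intro measurable_restrict_space2) (auto simp: h_def)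
  have nonneg: "0 \<le> log_gap m M (x + real n) - log_gap m M (x + real n + a)" if "x > 0" for x n
    using log_gap_antimono[of m M "x + real n" a] m a that by simp
  show ?thesis
  proof (rule generalized_stieltjesI_nn_integral)
    fix x :: real assume x: "x > 0"
    show "f x \<ge> 0"
      using sums_le[OF _ sums_zero sums[OF x]] nonneg[OF x] by blast
    have meas: "(\<lambda>t. ennreal (1 / (t + x) powr 3)) \<in> borel_measurable (restrict_space borel {0..})"
      by (intro measurable_restrict_space1) measurable
    have "(\<integral>\<^sup>+t. ennreal (1 / (t + x) powr 3) \<partial>\<nu>) =
          (\<integral>\<^sup>+v. w v * ennreal (1 / (h v + x) powr 3) \<partial>P)"
      unfolding \<nu>_def using meas
      by (subst nn_integral_distr, simp_all) (rule nn_integral_density, simp_all)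
    also have "\<dots> = (\<integral>\<^sup>+n. \<integral>\<^sup>+u. \<integral>\<^sup>+s. w ((n, u), s) * ennreal (1 / (h ((n, u), s) + x) powr 3)
          \<partial>lborel \<partial>lborel \<partial>count_space UNIV)"
      unfolding P_def w_def h_def
      by (subst lborel.nn_integral_fst[symmetric], measurable) (subst lborel.nn_integral_fst[symmetric], measurable)
    also have "\<dots> = (\<Sum>n. \<integral>\<^sup>+u. \<integral>\<^sup>+s. w ((n, u), s) * ennreal (1 / (h ((n, u), s) + x) powr 3)
          \<partial>lborel \<partial>lborel)"
      by (rule nn_integral_count_space_nat)
    also have "\<dots> = (\<Sum>n. ennreal (log_gap m M (x + real n) - log_gap m M (x + real n + a)))"
    proof (rule suminf_cong)
      fix n
      have "(\<integral>\<^sup>+s. w ((n, u), s) * ennreal (1 / (h ((n, u), s) + x) powr 3) \<partial>lborel) =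
            (\<integral>\<^sup>+s. ennreal (2 * tent m M s / (s + ((x + real n) + u)) ^ 3) \<partial>lborel) * indicator {0..a} u" for u
      proof (cases "u \<in> {0..a}")
        case True
        have "w ((n, u), s) * ennreal (1 / (h ((n, u), s) + x) powr 3) =
              ennreal (2 * tent m M s / (s + ((x + real n) + u)) ^ 3)" for s
        proof (cases "s < 0")
          case True
          then show ?thesis by (simp add: w_def tent_def)
        next
          case False
          \<comment> \<open>Positivity of the base is what turns \<open>powr 3\<close> into the
            cube.\<close>
          then have "h ((n, u), s) + x = s + ((x + real n) + u)" "h ((n, u), s) + x > 0"
            using \<open>u \<in> {0..a}\<close> x by (auto simp: h_def)
          then show ?thesis
            using \<open>u \<in> {0..a}\<close> tent_nonneg[OF m, of s]
            by (simp add: w_def ennreal_mult[symmetric] add_ac)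
        qed
        then show ?thesis using True by simp
      qed (simp add: w_def)
      then show "(\<integral>\<^sup>+u. \<integral>\<^sup>+s. w ((n, u), s) * ennreal (1 / (h ((n, u), s) + x) powr 3) \<partial>lborel \<partial>lborel)
        = ennreal (log_gap m M (x + real n) - log_gap m M (x + real n + a))"
        using nn_integral_tent_shift[of m M "x + real n" a] m a x by simp
    qed
    also have "\<dots> = ennreal (f x)"
      using sums[OF x] nonneg[OF x] by (simp add: suminf_ennreal2 sums_iff)
    finally show "(\<integral>\<^sup>+t. ennreal (1 / (t + x) powr 3) \<partial>\<nu>) = ennreal (f x)" .
  qed (simp_all add: \<nu>_def)
qed

text \<open>The terms ln (1 + 1/(x + k)) telescope, which produces \<open>b * ln x\<close>. The
  partial sums are therefore differences of the Gauss approximants \<open>ln_Gamma_series\<close>,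
  up to an error b (ln (x + n + 1) - ln n) that tends to 0.\<close>

lemma ln_Gamma_diff_sums:
  fixes x b :: real
  assumes "x > 0" "b > 0"
  shows "(\<lambda>n. ln (1 + b / (x + real n)) - b * ln (1 + 1 / (x + real n)))
           sums (ln_Gamma x - ln_Gamma (x + b) + b * ln x)"
proof -
  let ?t = "\<lambda>n. ln (1 + b / (x + real n)) - b * ln (1 + 1 / (x + real n))"
  \<comment> \<open>The second form matches the factors as written in
    \<open>ln_Gamma_series_def\<close>.\<close>
  have ln1: "ln (1 + c / y) = ln (y + c) - ln y" "ln (c / y + 1) = ln (y + c) - ln y"
    if "y > 0" "c > 0" for y c :: real
    using that ln_div[of "y + c" y] by (simp_all add: add_divide_distrib add.commute[of _ 1])
  \<comment> \<open>The case \<open>n = 0\<close> holds because \<open>ln 0 = 0\<close>.\<close>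
  have partial: "(\<Sum>k<Suc n. ?t k) = ln_Gamma_series x n - ln_Gamma_series (x + b) n + b * ln x
          - b * (ln (x + real (Suc n)) - ln (real n))" for n
  proof (induction n)
    case 0
    show ?case using assms by (simp add: ln_Gamma_series_def ln1 algebra_simps)
  next
    case (Suc n)
    have t: "?t (Suc n) = ln (x + b + real (Suc n)) - ln (x + real (Suc n))
            - b * (ln (x + real (Suc (Suc n))) - ln (x + real (Suc n)))"
      using assms by (simp add: ln1 add_ac)
    have step: "ln_Gamma_series y (Suc n) = ln_Gamma_series y n
        + y * (ln (real (Suc n)) - ln (real n)) - (ln (y + real (Suc n)) - ln (real (Suc n)))"
      if "y > 0" for y :: real
      using that by (simp add: ln_Gamma_series_def ln1 algebra_simps del: of_nat_Suc)
    have "?t (Suc n) + (ln_Gamma_series x n - ln_Gamma_series (x + b) n + b * ln x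
          - b * (ln (x + real (Suc n)) - ln (real n)))
        = ln_Gamma_series x (Suc n) - ln_Gamma_series (x + b) (Suc n) + b * ln x
          - b * (ln (x + real (Suc (Suc n))) - ln (real (Suc n)))"
      by (simp only: t step[OF assms(1)] step[OF add_pos_pos[OF assms]]) (simp only: algebra_simps)
    then show ?case
      by (subst sum.lessThan_Suc, subst Suc.IH) (simp only: add.commute)
  qed
  have "(\<lambda>n. ln (1 + (x + 1) / real n)) \<longlonglongrightarrow> ln (1 + 0)"
    by (intro tendsto_intros lim_const_over_n) simp
  moreover have "\<forall>\<^sub>F n in sequentially. ln (1 + (x + 1) / real n) = ln (x + real (Suc n)) - ln (real n)"
    using eventually_gt_at_top[of "0::nat"]
    by eventually_elim (use assms in \<open>simp add: ln1 add_ac\<close>)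
  ultimately have "(\<lambda>n. ln (x + real (Suc n)) - ln (real n)) \<longlonglongrightarrow> 0"
    using tendsto_cong by force
  then have "(\<lambda>n. ln_Gamma_series x n - ln_Gamma_series (x + b) n + b * ln x
          - b * (ln (x + real (Suc n)) - ln (real n))) \<longlonglongrightarrow>
          ln_Gamma x - ln_Gamma (x + b) + b * ln x - b * 0"
    using assms by (intro tendsto_intros ln_Gamma_real_LIMSEQ) auto
  then have "(\<lambda>n. \<Sum>k<Suc n. ?t k) \<longlonglongrightarrow> ln_Gamma x - ln_Gamma (x + b) + b * ln x"
    by (simp add: partial del: sum.lessThan_Suc)
  then show ?thesis
    unfolding sums_def by (subst (asm) filterlim_sequentially_Suc)
qed

text \<open>The correction \<open>- b * ln (1 + a / x)\<close> equals b ln x - b ln (x + a), exactly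
  the logarithmic terms of \<open>ln_Gamma_diff_sums\<close> at \<open>x\<close> and at
  \<open>x + a\<close>, so the two series can be subtracted.\<close>

lemma stieltjes_phi_sums:
  assumes "a > 0" "b > 0" "x > 0"
  shows "(\<lambda>n. (ln (1 + b / (x + real n)) - b * ln (1 + 1 / (x + real n))) -
              (ln (1 + b / (x + real n + a)) - b * ln (1 + 1 / (x + real n + a))))
           sums stieltjes_phi a b x"
proof -
  have "ln (Gamma (x + a + b) * Gamma x / (Gamma (x + a) * Gamma (x + b))) =
      ln_Gamma (x + a + b) + ln_Gamma x - (ln_Gamma (x + a) + ln_Gamma (x + b))"
    using assms by (simp add: ln_mult ln_div Gamma_real_pos_exp exp_add[symmetric] exp_diff[symmetric])
  moreover have "1 + a / x = (x + a) / x" using assms by (simp add: field_simps)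
  then have "ln (1 + a / x) = ln (x + a) - ln x"
    using assms by (simp add: ln_div)
  ultimately have "stieltjes_phi a b x = (ln_Gamma x - ln_Gamma (x + b) + b * ln x) -
      (ln_Gamma (x + a) - ln_Gamma (x + a + b) + b * ln (x + a))"
    unfolding stieltjes_phi_def by (simp only: right_diff_distrib)
  moreover have "(\<lambda>n. (ln (1 + b / (x + real n)) - b * ln (1 + 1 / (x + real n))) -
              (ln (1 + b / (x + a + real n)) - b * ln (1 + 1 / (x + a + real n))))
       sums ((ln_Gamma x - ln_Gamma (x + b) + b * ln x) -
      (ln_Gamma (x + a) - ln_Gamma (x + a + b) + b * ln (x + a)))"
    using assms by (intro sums_diff ln_Gamma_diff_sums) auto
  ultimately show ?thesis by (simp add: add.commute add.left_commute)
qed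

theorem theorem1p1:
  shows "(\<forall>a b. a > 0 \<and> 0 < b \<and> b < 1 \<longrightarrow> generalized_stieltjes 3 (stieltjes_phi a b)) \<and>
         (\<forall>a b. a > 0 \<and> b > 1 \<longrightarrow> generalized_stieltjes 3 (\<lambda>x. - stieltjes_phi a b x))"
proof (intro conjI allI impI; elim conjE)
  fix a b :: real assume "a > 0" "0 < b" "b < 1"
  then show "generalized_stieltjes 3 (stieltjes_phi a b)"
    using stieltjes_phi_sums[of a b]
    by (intro generalized_stieltjes_sums_log_gap[of b 1 a]) (simp_all add: log_gap_def)
next
  \<comment> \<open>The smaller parameter must come first in \<open>log_gap\<close>; for
    \<open>b > 1\<close> this swaps 1 and \<open>b\<close> and reverses the sign.\<close>
  fix a b :: real assume ab: "a > 0" "b > 1"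
  show "generalized_stieltjes 3 (\<lambda>x. - stieltjes_phi a b x)"
  proof (rule generalized_stieltjes_sums_log_gap[of 1 b a])
    fix x :: real assume "x > 0"
    then show "(\<lambda>n. log_gap 1 b (x + real n) - log_gap 1 b (x + real n + a)) sums - stieltjes_phi a b x"
      using sums_minus[OF stieltjes_phi_sums[of a b x]] ab by (simp add: log_gap_def algebra_simps)
  qed (use ab in auto)
qed

end
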